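(* $\mathfrak{hlt}=\mathfrak{hlt}'=\mathfrak r$.
   Context: A tree is an initial subset of $(2^{<\omega},\subseteq)$ without maximal elements; it is perfect if every node has two incompatible extensions in the tree; $\mathbf S$ denotes the set of perfect trees. For a tree $p$ and $A\subseteq\omega$, $p\restriction A=\{s\in p\cap 2^n: n\in A\}$. A family $\mathcal R\subseteq[\omega]^\omega$ is a Halpern--Läuchli family if for every $c:2^{<\omega}\to 2$ there are $p\in\mathbf S$ and $A\in\mathcal R$ such that $c$ is constant on $p\restriction A$; it is a Halpern--Läuchli family by levels if for every $c:2^{<\omega}\to2$ there are $p\in\mathbf S$ and $A\in\mathcal R$ such that $c$ is constant on $p\restriction\{n\}$ for each $n\in A$. $\mathfrak{hlt}$ (resp.\ $\mathfrak{hlt}'$) is the minimal size of a Halpern--Läuchli family (resp.\ Halpern--Läuchli family by levels). $\mathfrak r$ is the minimal size of a reaping family, where $\mathcal R\subseteq[\omega]^\omega$ is reaping if for every $A\in[\omega]^\omega$ there is $R\in\mathcal R$ with $R\subseteq A$ or $R\cap A=\emptyset$. *)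

theory Defs
  imports Main "HOL-Library.Sublist"
begin

unbundle cardinal_syntax

text \<open>The tree $2^{<\omega}$ is the type \<^typ>\<open>bool list\<close>, ordered by \<^const>\<open>prefix\<close>.\<close>

text \<open>Nonemptiness is part of the notion of a tree: the empty set is an initial subset
  without maximal elements, vacuously perfect, and would trivialise the families below.\<close>

definition is_tree :: "bool list set \<Rightarrow> bool" where
  "is_tree p \<longleftrightarrow> p \<noteq> {} \<and> (\<forall>t\<in>p. \<forall>s. prefix s t \<longrightarrow> s \<in> p) \<and> (\<forall>s\<in>p. \<exists>t\<in>p. strict_prefix s t)"

definition perfect_tree :: "bool list set \<Rightarrow> bool" where
  "perfect_tree p \<longleftrightarrow> is_tree p \<and>
     (\<forall>s\<in>p. \<exists>t\<in>p. \<exists>u\<in>p. prefix s t \<and> prefix s u \<and> parallel t u)"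

definition restrict_levels :: "bool list set \<Rightarrow> nat set \<Rightarrow> bool list set" (infixl \<open>\<restriction>\<^sub>l\<close> 90) where
  "p \<restriction>\<^sub>l A = {s \<in> p. length s \<in> A}"

definition const_on :: "('a \<Rightarrow> 'b) \<Rightarrow> 'a set \<Rightarrow> bool" where
  "const_on c X \<longleftrightarrow> (\<exists>i. \<forall>x\<in>X. c x = i)"

definition HL_family :: "nat set set \<Rightarrow> bool" where
  "HL_family \<R> \<longleftrightarrow> \<R> \<subseteq> {A. infinite A} \<and>
     (\<forall>c :: bool list \<Rightarrow> bool. \<exists>p. perfect_tree p \<and> (\<exists>A\<in>\<R>. const_on c (p \<restriction>\<^sub>l A)))"

definition HL_family_levels :: "nat set set \<Rightarrow> bool" where
  "HL_family_levels \<R> \<longleftrightarrow> \<R> \<subseteq> {A. infinite A} \<and>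
     (\<forall>c :: bool list \<Rightarrow> bool. \<exists>p. perfect_tree p \<and> (\<exists>A\<in>\<R>. \<forall>n\<in>A. const_on c (p \<restriction>\<^sub>l {n})))"

definition reaping_family :: "nat set set \<Rightarrow> bool" where
  "reaping_family \<R> \<longleftrightarrow> \<R> \<subseteq> {A. infinite A} \<and>
     (\<forall>A. infinite A \<longrightarrow> (\<exists>R\<in>\<R>. R \<subseteq> A \<or> R \<inter> A = {}))"

text \<open>A cardinal is represented, up to \<open>=o\<close>, by a cardinal order. The value below is
  meaningful only if some \<open>X\<close> satisfies \<open>P\<close>; it is then
  the least cardinality of such an \<open>X\<close> (lemmas \<open>min_size_attained\<close>, \<open>min_size_le\<close>).\<close>

definition min_size :: "('a set \<Rightarrow> bool) \<Rightarrow> 'a rel" where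
  "min_size P = |SOME X. P X \<and> (\<forall>Y. P Y \<longrightarrow> |X| \<le>o |Y| )|"

lemma min_size_witness:
  assumes "P Z"
  shows "\<exists>X. P X \<and> min_size P = |X| \<and> (\<forall>Y. P Y \<longrightarrow> |X| \<le>o |Y| )"
proof -
  have "\<exists>r \<in> card_of ` {X. P X}. \<forall>r' \<in> card_of ` {X. P X}. r \<le>o r'"
    using assms by (intro exists_minim_Card_order) (auto simp: card_of_Card_order)
  then have "\<exists>X. P X \<and> (\<forall>Y. P Y \<longrightarrow> |X| \<le>o |Y| )"
    by auto
  from someI_ex[OF this] show ?thesis
    unfolding min_size_def by blast
qed

lemma min_size_attained: "P Z \<Longrightarrow> \<exists>X. P X \<and> |X| =o min_size P"
  using min_size_witness[of P Z] card_of_refl by metis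

lemma min_size_le: "P Z \<Longrightarrow> min_size P \<le>o |Z|"
  using min_size_witness[of P Z] by metis

definition hlt :: "nat set rel" where
  "hlt = min_size HL_family"

definition hlt' :: "nat set rel" where
  "hlt' = min_size HL_family_levels"

definition reaping_number :: "nat set rel" (\<open>\<rr>\<close>) where
  "\<rr> = min_size reaping_family"

end

theory Submission
  imports Defs "HOL-Library.Countable_Set_Type"
begin

text \<open>
  The inequality \<open>hlt' \<le> hlt\<close> is immediate.

  For \<open>hlt \<le> \<rr>\<close>, let \<open>\<R>\<close> be reaping and let \<open>c\<close> be a colouring. Along each branch \<open>x\<close>, some
  \<open>R \<in> \<R>\<close> makes \<open>c\<close> constant on the levels in \<open>R\<close>. If for some \<open>R\<close> the set of branches it serves
  with one fixed colour is uncountable, the nodes lying on uncountably many of them form a perfect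
  tree, and \<open>R\<close> witnesses the Halpern--Laeuchli property for \<open>c\<close>. Otherwise \<open>2\<^sup>\<omega>\<close> is covered by
  \<open>\<bar>\<R>\<bar>\<close> countable sets, so \<open>\<R>\<close> has size continuum, and the family of all infinite sets,
  which is Halpern--Laeuchli by the one-dimensional theorem, is no larger.

  For \<open>\<rr> \<le> hlt'\<close>, let \<open>\<R>\<close> have size less than \<open>\<rr>\<close>. Splitting repeatedly gives a
  \<open>k : \<omega> \<rightarrow> \<omega>\<close> such that every fibre of \<open>k\<close> meets every \<open>A \<in> \<R>\<close> in an infinite set. Colour a
  node \<open>s\<close> by its bit at position \<open>k \<bar>s\<bar>\<close>. A tree on which this is constant on each level of some
  \<open>A \<in> \<R>\<close> cannot split anywhere.
\<close>

section \<open>Perfect trees\<close>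

lemma perfect_treeI:
  assumes "p \<noteq> {}"
    and "\<And>s t. t \<in> p \<Longrightarrow> prefix s t \<Longrightarrow> s \<in> p"
    and split: "\<And>s. s \<in> p \<Longrightarrow> \<exists>t\<in>p. \<exists>u\<in>p. prefix s t \<and> prefix s u \<and> parallel t u"
  shows "perfect_tree p"
proof -
  have "\<exists>t\<in>p. strict_prefix s t" if "s \<in> p" for s
    using split[OF that] by (metis parallelE prefix_order.le_neq_trans)
  then show ?thesis
    using assms unfolding perfect_tree_def is_tree_def by blast
qed

lemma tree_extend:
  assumes "is_tree p" "s \<in> p" "length s \<le> n"
  shows "\<exists>t\<in>p. prefix s t \<and> length t = n"
  using assms(3)
proof (induction n rule: dec_induct)
  case base
  then show ?case using assms(2) by auto
next
  case (step n)
  then obtain t where t: "t \<in> p" "prefix s t" "length t = n" by blast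
  then obtain u where u: "u \<in> p" "strict_prefix t u"
    using assms(1) unfolding is_tree_def by blast
  let ?v = "take (Suc n) u"
  have "Suc n \<le> length u"
    using prefix_length_less[OF u(2)] t(3) by simp
  moreover have "?v \<in> p"
    using u(1) assms(1) take_is_prefix unfolding is_tree_def by blast
  moreover have "prefix t ?v"
    using u(2) t(3) \<open>Suc n \<le> length u\<close>
    by (metis le_SucI length_take min.absorb2 order_refl prefix_length_prefix
        prefix_order.less_imp_le take_is_prefix)
  ultimately show ?case
    using t(2) by (intro bexI[of _ ?v]) auto
qed

lemma parallel_imp_nth_neq:
  assumes "parallel s t"
  shows "\<exists>m. m < length s \<and> m < length t \<and> s ! m \<noteq> t ! m"
proof -
  obtain as b bs c cs where "b \<noteq> c" "s = as @ b # bs" "t = as @ c # cs"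
    using parallel_decomp[OF assms] by blast
  then show ?thesis
    by (intro exI[of _ "length as"]) auto
qed

text \<open>A branch is encoded as the set of positions of its bits \<open>True\<close>. Thus
  \<open>nat set\<close> plays the role of the space of branches, and its cardinality is literally
  that of \<open>UNIV :: nat set set\<close>.\<close>

definition branch_restrict :: "nat set \<Rightarrow> nat \<Rightarrow> bool list" where
  "branch_restrict x n = map (\<lambda>i. i \<in> x) [0..<n]"

lemma length_branch_restrict [simp]: "length (branch_restrict x n) = n"
  by (simp add: branch_restrict_def)

lemma prefix_branch_restrict:
  assumes "prefix s (branch_restrict x n)"
  shows "branch_restrict x (length s) = s"
proof -
  have "s = take (length s) (branch_restrict x n)"
    using assms by (auto elim: prefixE)
  moreover have "length s \<le> n"
    using prefix_length_le[OF assms] by simp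
  ultimately show ?thesis
    by (metis add_0 branch_restrict_def take_map take_upt)
qed

lemma branch_restrict_prefix:
  "m \<le> n \<Longrightarrow> prefix (branch_restrict x m) (branch_restrict x n)"
  by (metis add_0 branch_restrict_def take_is_prefix take_map take_upt)

text \<open>Every node lying on uncountably many branches of \<open>X\<close> has incompatible extensions of the same
  kind: otherwise all but one of those branches pass through some node that lies on only countably
  many branches of \<open>X\<close>, and there are countably many nodes.\<close>

lemma perfect_tree_uncountable:
  assumes "uncountable X"
  shows "perfect_tree {s. uncountable {x\<in>X. branch_restrict x (length s) = s}}"
    (is "perfect_tree {s. uncountable (?B s)}")
proof (rule perfect_treeI)
  have "?B [] = X" by (auto simp: branch_restrict_def)
  then have "[] \<in> {s. uncountable (?B s)}" using assms by simp
  then show "{s. uncountable (?B s)} \<noteq> {}" by blast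
next
  fix s t assume "t \<in> {s. uncountable (?B s)}" "prefix s t"
  moreover have "?B t \<subseteq> ?B s"
  proof safe
    fix x assume "branch_restrict x (length t) = t"
    then show "branch_restrict x (length s) = s"
      using \<open>prefix s t\<close> prefix_branch_restrict[of s x "length t"] by simp
  qed
  ultimately show "s \<in> {s. uncountable (?B s)}"
    using countable_subset by blast
next
  fix s assume s: "s \<in> {s. uncountable (?B s)}"
  let ?T = "{s. uncountable (?B s)}"
  show "\<exists>t\<in>?T. \<exists>u\<in>?T. prefix s t \<and> prefix s u \<and> parallel t u"
  proof (rule ccontr)
    assume no: "\<not> ?thesis"
    let ?Y = "{x \<in> ?B s. \<forall>n. branch_restrict x n \<in> ?T}"
    have uniq: "x = y" if x: "x \<in> ?Y" and y: "y \<in> ?Y" for x y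
    proof (rule ccontr)
      assume "x \<noteq> y"
      then obtain m where m: "(m \<in> x) \<noteq> (m \<in> y)" by blast
      \<comment> \<open>Past \<open>m\<close> the two restrictions differ; past
        \<open>length s\<close> both extend \<open>s\<close>.\<close>
      define n where "n = max (Suc m) (length s)"
      have "m < n" "length s \<le> n" by (auto simp: n_def)
      have "branch_restrict x n ! m \<noteq> branch_restrict y n ! m"
        using m \<open>m < n\<close> by (simp add: branch_restrict_def)
      then have "parallel (branch_restrict x n) (branch_restrict y n)"
        by (metis length_branch_restrict not_equal_is_parallel)
      moreover have "prefix s (branch_restrict x n)" "prefix s (branch_restrict y n)"
        using x y branch_restrict_prefix[OF \<open>length s \<le> n\<close>]
        by (metis (mono_tags, lifting) mem_Collect_eq)+
      moreover have "branch_restrict x n \<in> ?T" "branch_restrict y n \<in> ?T"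
        using x y by blast+
      ultimately show False using no by blast
    qed
    have "countable ?Y"
    proof (cases "?Y = {}")
      case False
      then obtain y where "y \<in> ?Y" by blast
      then have "?Y \<subseteq> {y}" using uniq by blast
      then show ?thesis by (rule countable_subset) simp
    next
      case True
      show ?thesis unfolding True by simp
    qed
    moreover have "countable (\<Union>t\<in>-?T. ?B t)"
      by (intro countable_UN) auto
    moreover have "?B s \<subseteq> ?Y \<union> (\<Union>t\<in>-?T. ?B t)"
    proof
      fix x assume x: "x \<in> ?B s"
      show "x \<in> ?Y \<union> (\<Union>t\<in>-?T. ?B t)"
      proof (cases "\<forall>n. branch_restrict x n \<in> ?T")
        case False
        then obtain n where n: "branch_restrict x n \<in> -?T" by blast
        have "x \<in> ?B (branch_restrict x n)" using x by simp
        then show ?thesis using n by blast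
      qed (use x in blast)
    qed
    ultimately have "countable (?B s)"
      by (meson countable_Un countable_subset)
    then show False using s by blast
  qed
qed

section \<open>All infinite sets form a Halpern--Laeuchli family\<close>

lemma perfect_tree_cone: "perfect_tree {u. prefix u t \<or> prefix t u}"
proof (rule perfect_treeI)
  fix s assume s: "s \<in> {u. prefix u t \<or> prefix t u}"
  obtain u where u: "prefix s u" "prefix t u"
    using s by blast
  then show "\<exists>v\<in>{u. prefix u t \<or> prefix t u}. \<exists>w\<in>{u. prefix u t \<or> prefix t u}.
      prefix s v \<and> prefix s w \<and> parallel v w"
    by (intro bexI[of _ "u @ [True]"] bexI[of _ "u @ [False]"])
       (auto intro: not_equal_is_parallel)
next
  show "s \<in> {u. prefix u t \<or> prefix t u}" if "v \<in> {u. prefix u t \<or> prefix t u}" "prefix s v" for s v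
    using that prefix_same_cases[of s v t] prefix_order.trans[of s v t] by blast
qed blast

text \<open>A fusion argument: from a node at level \<open>a i\<close>, branch by appending either
  bit, then extend to a node of colour \<open>c\<close> at the next level. The bound
  \<open>Suc (a i)\<close> makes room for the appended bit. The tree is the downward closure of the
  nodes obtained.\<close>

lemma perfect_tree_levels:
  fixes a :: "nat \<Rightarrow> nat"
  assumes mono: "\<And>i. a i < a (Suc i)"
    and ext: "\<And>i t. length t \<le> Suc (a i) \<Longrightarrow> \<exists>u. prefix t u \<and> length u = a (Suc i) \<and> c u"
  shows "\<exists>p. perfect_tree p \<and> (\<forall>s \<in> p \<restriction>\<^sub>l range (\<lambda>i. a (Suc i)). c s)"
proof -
  have smono: "strict_mono a" using mono by (simp add: strict_mono_Suc_iff)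
  \<comment> \<open>The colour is required at all earlier distinguished levels as well, so that it
    holds for every prefix of \<open>u\<close> lying on such a level.\<close>
  define good where
    "good u i \<longleftrightarrow> length u = a (Suc i) \<and> (\<forall>j\<le>i. c (take (a (Suc j)) u))" for u i
  define p where "p = {s. \<exists>u i. prefix s u \<and> good u i}"
  have goodI: "\<exists>v. prefix (u @ [b]) v \<and> good v (Suc i)" if u: "good u i" for u b i
  proof -
    obtain v where v: "prefix (u @ [b]) v" "length v = a (Suc (Suc i))" "c v"
      using ext[of "u @ [b]" "Suc i"] u by (auto simp: good_def)
    have "c (take (a (Suc j)) v)" if "j \<le> Suc i" for j
    proof (cases "j = Suc i")
      case False
      then have "j \<le> i" using that by simp
      then have "a (Suc j) \<le> length u"
        using u smono by (simp add: good_def strict_mono_less_eq)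
      then have "take (a (Suc j)) v = take (a (Suc j)) u"
        using v(1) by (auto elim!: prefixE)
      then show ?thesis using u \<open>j \<le> i\<close> by (simp add: good_def)
    qed (use v in simp)
    then show ?thesis using v by (auto simp: good_def)
  qed
  have "perfect_tree p"
  proof (rule perfect_treeI)
    obtain u where "length u = a (Suc 0)" "c u" using ext[of "[]" 0] by auto
    then have "good u 0" by (simp add: good_def)
    then show "p \<noteq> {}" by (auto simp: p_def)
  next
    show "s \<in> p" if "t \<in> p" "prefix s t" for s t
      using that by (auto simp: p_def intro: prefix_order.trans)
  next
    fix s assume "s \<in> p"
    then obtain u i where u: "prefix s u" "good u i" by (auto simp: p_def)
    obtain v w where vw: "prefix (u @ [True]) v" "good v (Suc i)"
        "prefix (u @ [False]) w" "good w (Suc i)"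
      using goodI[OF u(2)] by metis
    have "v \<noteq> w" using vw(1,3) by (auto elim!: prefixE)
    moreover have "length v = length w" using vw by (simp add: good_def)
    ultimately have "parallel v w" by (intro not_equal_is_parallel)
    moreover have "prefix s v" "prefix s w"
      using u(1) vw by (meson prefix_order.trans prefixI)+
    moreover have "v \<in> p" "w \<in> p" using vw by (auto simp: p_def)
    ultimately show "\<exists>t\<in>p. \<exists>u\<in>p. prefix s t \<and> prefix s u \<and> parallel t u" by blast
  qed
  moreover have "c s" if s_level: "s \<in> p \<restriction>\<^sub>l range (\<lambda>i. a (Suc i))" for s
  proof -
    obtain u i j where s: "prefix s u" "good u i" "length s = a (Suc j)"
      using s_level unfolding p_def restrict_levels_def by blast
    have "a (Suc j) \<le> a (Suc i)"
      using prefix_length_le[OF s(1)] s by (simp add: good_def)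
    then have "j \<le> i" using smono by (simp add: strict_mono_less_eq)
    moreover have "take (a (Suc j)) u = s" using s(1,3) by (auto elim!: prefixE)
    ultimately show ?thesis using s(2) by (auto simp: good_def)
  qed
  ultimately show ?thesis by blast
qed

text \<open>If some \<open>t\<close> has infinitely many levels on which no extension of
  \<open>t\<close> has colour \<open>True\<close>, the cone of \<open>t\<close> is
  \<open>False\<close> there. Otherwise the finitely many nodes of length at most
  \<open>Suc m\<close> exclude only finitely many levels, so one later level serves them all, and
  fusion applies.\<close>

lemma HL_family_infinite_sets: "HL_family {A. infinite A}"
  unfolding HL_family_def
proof (intro conjI allI subset_refl)
  fix c :: "bool list \<Rightarrow> bool"
  let ?N = "\<lambda>t. {n. \<forall>u. prefix t u \<and> length u = n \<longrightarrow> \<not> c u}"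
  show "\<exists>p. perfect_tree p \<and> (\<exists>A\<in>{A. infinite A}. const_on c (p \<restriction>\<^sub>l A))"
  proof (cases "\<exists>t. infinite (?N t)")
    case True
    then obtain t where t: "infinite (?N t)" by blast
    \<comment> \<open>Below \<open>length t\<close> the cone consists of prefixes of
      \<open>t\<close>, whose colours are not controlled.\<close>
    let ?A = "?N t - {..<length t}" and ?p = "{u. prefix u t \<or> prefix t u}"
    have "\<not> c u" if u: "u \<in> ?p \<restriction>\<^sub>l ?A" for u
    proof -
      have "prefix t u"
        using u prefix_length_le[of u t] by (auto simp: restrict_levels_def prefix_def)
      then show ?thesis using u by (auto simp: restrict_levels_def)
    qed
    then have "const_on c (?p \<restriction>\<^sub>l ?A)" by (auto simp: const_on_def)
    moreover have "infinite ?A" using t by simp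
    ultimately show ?thesis using perfect_tree_cone by blast
  next
    case False
    have "\<exists>n>m. \<forall>t. length t \<le> Suc m \<longrightarrow> (\<exists>u. prefix t u \<and> length u = n \<and> c u)" for m
    proof -
      have "finite {t::bool list. length t \<le> Suc m}"
        using finite_lists_length_le[of "UNIV::bool set"] by simp
      then have "finite ({..m} \<union> (\<Union>t\<in>{t. length t \<le> Suc m}. ?N t))"
        using False by blast
      then obtain n where "n \<notin> {..m} \<union> (\<Union>t\<in>{t. length t \<le> Suc m}. ?N t)"
        using ex_new_if_finite infinite_UNIV_nat by blast
      then show ?thesis by (intro exI[of _ n]) auto
    qed
    then obtain f where f: "\<And>m. f m > m"
        "\<And>m t. length t \<le> Suc m \<Longrightarrow> \<exists>u. prefix t u \<and> length u = f m \<and> c u"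
      by metis
    define a where "a i = (f ^^ i) 0" for i
    have mono: "a i < a (Suc i)" for i using f(1) by (simp add: a_def)
    obtain p where p: "perfect_tree p" "\<forall>s \<in> p \<restriction>\<^sub>l range (\<lambda>i. a (Suc i)). c s"
      using perfect_tree_levels[of a c] mono f(2) by (auto simp: a_def)
    have "inj (\<lambda>i. a (Suc i))"
      using mono by (intro strict_mono_imp_inj_on) (simp add: strict_mono_Suc_iff)
    then have "infinite (range (\<lambda>i. a (Suc i)))"
      using finite_imageD infinite_UNIV_nat by blast
    moreover have "const_on c (p \<restriction>\<^sub>l range (\<lambda>i. a (Suc i)))"
      using p(2) by (auto simp: const_on_def)
    ultimately show ?thesis using p(1) by blast
  qed
qed

section \<open>Reaping families\<close>

text \<open>Given an enumeration \<open>F\<close>, choose an increasing sequence with two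
  consecutive terms in each \<open>F n\<close>. The even-indexed terms then form a set that splits
  every member.\<close>

lemma reaping_family_uncountable:
  assumes "reaping_family \<R>"
  shows "uncountable \<R>"
proof
  assume "countable \<R>"
  have inf: "infinite A" if "A \<in> \<R>" for A using assms that by (auto simp: reaping_family_def)
  have "\<R> \<noteq> {}"
    using assms infinite_UNIV_nat unfolding reaping_family_def by blast
  then obtain F :: "nat \<Rightarrow> nat set" where F: "range F = \<R>"
    using range_from_nat_into[OF _ \<open>countable \<R>\<close>] by blast
  have step: "\<exists>z. z > y \<and> z \<in> F (Suc n div 2)" for y n
    using inf[of "F (Suc n div 2)"] F by (auto simp: infinite_nat_iff_unbounded)
  have "\<exists>f. \<forall>n. f n \<in> F (n div 2) \<and> f n < f (Suc n)"
  proof (rule dependent_nat_choice)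
    show "\<exists>x. x \<in> F (0 div 2)"
      using inf[of "F 0"] F by (metis div_0 ex_in_conv finite.emptyI rangeI)
    show "\<exists>z. z \<in> F (Suc n div 2) \<and> y < z" for y n
      using step by blast
  qed
  then obtain f where f: "\<And>n. f n \<in> F (n div 2)" "strict_mono f"
    by (auto simp: strict_mono_Suc_iff)
  have inj: "inj f" using f(2) by (rule strict_mono_imp_inj_on)
  let ?X = "range (\<lambda>n. f (2 * n))"
  have "infinite ?X"
    using inj by (intro range_inj_infinite injI) (simp add: inj_eq)
  then obtain R where R: "R \<in> \<R>" "R \<subseteq> ?X \<or> R \<inter> ?X = {}"
    using assms unfolding reaping_family_def by blast
  obtain n where n: "R = F n" using R(1) F by blast
  have "f (2 * n) \<in> R \<inter> ?X" "f (Suc (2 * n)) \<in> R"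
    using f(1)[of "2 * n"] f(1)[of "Suc (2 * n)"] n by auto
  moreover have "f (Suc (2 * n)) \<notin> ?X"
  proof
    assume "f (Suc (2 * n)) \<in> ?X"
    then obtain k where "f (Suc (2 * n)) = f (2 * k)" by blast
    then have "Suc (2 * n) = 2 * k" using inj by (simp add: inj_eq)
    then show False by presburger
  qed
  ultimately show False using R(2) by blast
qed

lemma reaping_family_HL_or_continuum:
  assumes "reaping_family \<R>"
  shows "HL_family \<R> \<or> |UNIV :: nat set set| \<le>o |\<R>|"
proof (rule disjCI)
  assume not_le: "\<not> |UNIV :: nat set set| \<le>o |\<R>|"
  have unc: "uncountable \<R>" using assms by (rule reaping_family_uncountable)
  then have inf: "infinite \<R>" using uncountable_infinite by blast
  show "HL_family \<R>"
    unfolding HL_family_def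
  proof (intro conjI allI)
    show "\<R> \<subseteq> {A. infinite A}" using assms by (simp add: reaping_family_def)
    fix c :: "bool list \<Rightarrow> bool"
    let ?X = "\<lambda>R i. {x. \<forall>n\<in>R. c (branch_restrict x n) = i}"
    have cover: "x \<in> (\<Union>R\<in>\<R>. ?X R True \<union> ?X R False)" for x
    proof -
      let ?S = "{n. c (branch_restrict x n)}"
      have "\<exists>R\<in>\<R>. R \<subseteq> ?S \<or> R \<inter> ?S = {}"
      \<comment> \<open>Reaping speaks of infinite sets only; if \<open>?S\<close> is finite, it is
        applied to the complement, where the two alternatives swap.\<close>
      proof (cases "finite ?S")
        case True
        then have "infinite (- ?S)" using infinite_UNIV_nat by (metis finite_compl)
        then obtain R where "R \<in> \<R>" "R \<subseteq> - ?S \<or> R \<inter> - ?S = {}"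
          using assms unfolding reaping_family_def by blast
        then show ?thesis by blast
      qed (use assms in \<open>auto simp: reaping_family_def\<close>)
      then show ?thesis by blast
    qed
    have "\<exists>R\<in>\<R>. \<exists>i. uncountable (?X R i)"
    proof (rule ccontr)
      assume "\<not> ?thesis"
      then have "countable (?X R True \<union> ?X R False)" if "R \<in> \<R>" for R
        using that by (intro countable_Un) blast+
      moreover have "|UNIV :: nat set| \<le>o |\<R>|"
        using inf by (simp add: infinite_iff_card_of_nat)
      ultimately have "\<forall>R\<in>\<R>. |?X R True \<union> ?X R False| \<le>o |\<R>|"
        using countable_card_of_nat ordLeq_transitive by blast
      then have "|\<Union>R\<in>\<R>. ?X R True \<union> ?X R False| \<le>o |\<R>|"
        by (intro card_of_UNION_ordLeq_infinite[OF inf ordLeq_refl[OF card_of_Card_order]])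
      moreover have "(\<Union>R\<in>\<R>. ?X R True \<union> ?X R False) = UNIV" using cover by blast
      ultimately show False using not_le by simp
    qed
    then obtain R i where R: "R \<in> \<R>" "uncountable (?X R i)" by blast
    let ?p = "{s. uncountable {x\<in>?X R i. branch_restrict x (length s) = s}}"
    have "c s = i" if s: "s \<in> ?p \<restriction>\<^sub>l R" for s
    proof -
      have "uncountable {x\<in>?X R i. branch_restrict x (length s) = s}"
        using s by (simp add: restrict_levels_def)
      \<comment> \<open>Uncountability is used only for nonemptiness: one branch in
        \<open>?X R i\<close> through \<open>s\<close> determines the colour of
        \<open>s\<close>.\<close>
      then obtain x where "x \<in> ?X R i" "branch_restrict x (length s) = s"
        by (metis (mono_tags, lifting) Collect_empty_eq countable_empty)
      moreover have "length s \<in> R" using s by (simp add: restrict_levels_def)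
      ultimately show ?thesis by auto
    qed
    then have "const_on c (?p \<restriction>\<^sub>l R)" unfolding const_on_def by (intro exI[of _ i] ballI)
    then show "\<exists>p. perfect_tree p \<and> (\<exists>A\<in>\<R>. const_on c (p \<restriction>\<^sub>l A))"
      using perfect_tree_uncountable[OF R(2)] R(1)
      by (intro exI[of _ ?p] conjI bexI[of _ R])
  qed
qed

text \<open>Not being reaping only yields a set that meets every member and its complement. Applied
  to the family of all tails of members of \<R>, this gives infinitely many points on both
  sides.\<close>

lemma splitting_set_exists:
  fixes \<R> :: "nat set set"
  assumes small: "|\<R>| <o \<rr>" and inf: "\<And>A. A \<in> \<R> \<Longrightarrow> infinite A"
  shows "\<exists>X. \<forall>A\<in>\<R>. infinite (A \<inter> X) \<and> infinite (A - X)"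
proof -
  let ?S = "(\<lambda>(A, n). A - {..<n}) ` (\<R> \<times> (UNIV :: nat set))"
  have "\<not> reaping_family ?S"
  proof
    assume reap: "reaping_family ?S"
    \<comment> \<open>For countable \<R> the family of tails is countable, hence not reaping; for
      infinite \<R> adding tails does not raise the cardinality.\<close>
    have "uncountable \<R>"
      using reaping_family_uncountable[OF reap] by blast
    then have "infinite \<R>" using uncountable_infinite by blast
    moreover from this have "|UNIV :: nat set| \<le>o |\<R>|"
      by (simp add: infinite_iff_card_of_nat)
    ultimately have "|\<R> \<times> (UNIV :: nat set)| \<le>o |\<R>|"
      using card_of_Times_infinite ordIso_imp_ordLeq by blast
    then have "|?S| \<le>o |\<R>|"
      using card_of_image ordLeq_transitive by blast
    moreover have "\<rr> \<le>o |?S|"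
      unfolding reaping_number_def by (rule min_size_le[of reaping_family, OF reap])
    ultimately show False
      using small by (meson not_ordLess_ordLeq ordLeq_transitive)
  qed
  moreover have "?S \<subseteq> {A. infinite A}" using inf by auto
  ultimately obtain X where "\<not> (\<exists>R\<in>?S. R \<subseteq> X \<or> R \<inter> X = {})"
    unfolding reaping_family_def by metis
  then have X: "\<not> A - {..<n} \<subseteq> X" "(A - {..<n}) \<inter> X \<noteq> {}" if "A \<in> \<R>" for A n
    using that by auto
  have "infinite (A \<inter> X) \<and> infinite (A - X)" if "A \<in> \<R>" for A
  proof -
    have "\<exists>k\<ge>n. k \<in> A - X" "\<exists>k\<ge>n. k \<in> A \<inter> X" for n
      using X[OF that, of n] by (auto simp: subset_iff disjoint_iff not_less)
    then show ?thesis by (simp add: infinite_nat_iff_unbounded_le)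
  qed
  then show ?thesis by blast
qed

text \<open>Splitting the traces of \<R> on \<open>B m\<close> gives a decreasing sequence in which
  every difference \<open>B m - B (Suc m)\<close> meets each \<open>A\<close> infinitely often.
  These differences are placed in distinct fibres of \<open>k\<close>.\<close>

lemma fibres_meet_small_family:
  assumes small: "|\<R>| <o \<rr>" and inf: "\<And>A. A \<in> \<R> \<Longrightarrow> infinite A"
  shows "\<exists>k :: nat \<Rightarrow> nat. \<forall>A\<in>\<R>. \<forall>m. infinite {n\<in>A. k n = m}"
proof -
  have "\<exists>B. \<forall>m. (\<forall>A\<in>\<R>. infinite (A \<inter> B m)) \<and>
      (B (Suc m) \<subseteq> B m \<and> (\<forall>A\<in>\<R>. infinite (A \<inter> (B m - B (Suc m)))))"
  proof (rule dependent_nat_choice)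
    show "\<exists>B. \<forall>A\<in>\<R>. infinite (A \<inter> B)"
      using inf by (intro exI[of _ UNIV]) auto
    fix B :: "nat set" and m :: nat
    assume B: "\<forall>A\<in>\<R>. infinite (A \<inter> B)"
    have "|(\<lambda>A. A \<inter> B) ` \<R>| <o \<rr>"
      using card_of_image small ordLeq_ordLess_trans by blast
    then obtain X where X: "\<forall>A\<in>\<R>. infinite (A \<inter> B \<inter> X) \<and> infinite (A \<inter> B - X)"
      using splitting_set_exists[of "(\<lambda>A. A \<inter> B) ` \<R>"] B by auto
    moreover have "A \<inter> (B - B \<inter> X) = A \<inter> B - X" for A by blast
    ultimately show "\<exists>C. (\<forall>A\<in>\<R>. infinite (A \<inter> C)) \<and>
        (C \<subseteq> B \<and> (\<forall>A\<in>\<R>. infinite (A \<inter> (B - C))))"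
      by (intro exI[of _ "B \<inter> X"]) (auto simp: Int_assoc)
  qed
  then obtain B where dec: "\<And>m. B (Suc m) \<subseteq> B m"
      and B: "\<And>m A. A \<in> \<R> \<Longrightarrow> infinite (A \<inter> (B m - B (Suc m)))"
    by blast
  \<comment> \<open>Numbers outside \<open>B 0\<close> get value 0 and those in every
    \<open>B m\<close> an unspecified value. This is harmless: the fibre over \<open>m\<close> need
    only contain \<open>B m - B (Suc m)\<close>.\<close>
  define k where "k n = (LEAST m. n \<notin> B (Suc m))" for n
  have k: "k n = m" if "n \<in> B m - B (Suc m)" for n m
    unfolding k_def
  proof (rule Least_equality)
    show "m \<le> j" if "n \<notin> B (Suc j)" for j
    proof (rule ccontr)
      assume "\<not> m \<le> j"
      then have "B m \<subseteq> B (Suc j)" using lift_Suc_antimono_le[of B, OF dec] by simp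
      then show False using that \<open>n \<in> B m - B (Suc m)\<close> by blast
    qed
  qed (use that in blast)
  have "infinite {n\<in>A. k n = m}" if "A \<in> \<R>" for A m
  proof (rule infinite_super)
    show "A \<inter> (B m - B (Suc m)) \<subseteq> {n\<in>A. k n = m}" using k by blast
  qed (rule B[OF that])
  then show ?thesis by blast
qed

section \<open>Comparing the cardinals\<close>

lemma HL_family_levels_ge_reaping_number:
  assumes "HL_family_levels \<R>"
  shows "\<rr> \<le>o |\<R>|"
proof (rule ccontr)
  have "Card_order \<rr>"
    unfolding reaping_number_def min_size_def by (rule card_of_Card_order)
  moreover assume "\<not> \<rr> \<le>o |\<R>|"
  ultimately have "|\<R>| <o \<rr>"
    using not_ordLeq_iff_ordLess[OF card_of_Well_order] card_order_on_well_order_on by blast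
  then obtain k :: "nat \<Rightarrow> nat" where k: "\<And>A m. A \<in> \<R> \<Longrightarrow> infinite {n\<in>A. k n = m}"
    using fibres_meet_small_family[of \<R>] assms unfolding HL_family_levels_def by blast
  \<comment> \<open>If \<open>k (length s)\<close> is not below \<open>length s\<close>, the colour
    is unspecified; below, \<open>c\<close> is evaluated only at nodes longer than
    \<open>m = k n\<close>.\<close>
  define c where "c s = s ! k (length s)" for s :: "bool list"
  obtain p A where p: "perfect_tree p" "A \<in> \<R>" "\<And>n. n \<in> A \<Longrightarrow> const_on c (p \<restriction>\<^sub>l {n})"
    using assms unfolding HL_family_levels_def by metis
  have tree: "is_tree p" using p(1) by (simp add: perfect_tree_def)
  obtain t u where tu: "t \<in> p" "u \<in> p" "parallel t u"
    using p(1) unfolding perfect_tree_def is_tree_def by blast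
  obtain m where m: "m < length t" "m < length u" "t ! m \<noteq> u ! m"
    using parallel_imp_nth_neq[OF tu(3)] by blast
  \<comment> \<open>The fibre over \<open>m\<close> is infinite in \<open>A\<close>, so it reaches a
    level above both nodes. There any extensions of \<open>t\<close> and \<open>u\<close> keep their
    different bits at \<open>m\<close>, which \<open>c\<close> reads.\<close>
  obtain n where n: "n \<ge> max (length t) (length u)" "n \<in> A" "k n = m"
    using k[OF p(2), of m] unfolding infinite_nat_iff_unbounded_le by blast
  obtain t' where t': "t' \<in> p" "prefix t t'" "length t' = n"
    using tree_extend[OF tree tu(1), of n] n(1) by auto
  obtain u' where u': "u' \<in> p" "prefix u u'" "length u' = n"
    using tree_extend[OF tree tu(2), of n] n(1) by auto
  have "c t' = c u'"
    using p(3)[OF n(2)] t' u' by (auto simp: const_on_def restrict_levels_def)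
  moreover have "c t' = t ! m" "c u' = u ! m"
    using t' u' m n(3) by (auto simp: c_def nth_append elim!: prefixE)
  ultimately show False using m(3) by simp
qed

lemma HL_family_imp_levels:
  assumes "HL_family \<R>"
  shows "HL_family_levels \<R>"
proof -
  have mono: "const_on c (p \<restriction>\<^sub>l {n})" if const: "const_on c (p \<restriction>\<^sub>l A)" and n: "n \<in> A"
    for c :: "bool list \<Rightarrow> bool" and p A n
  proof -
    have "p \<restriction>\<^sub>l {n} \<subseteq> p \<restriction>\<^sub>l A" using n by (auto simp: restrict_levels_def)
    then show ?thesis using const unfolding const_on_def by (meson subsetD)
  qed
  show ?thesis
    unfolding HL_family_levels_def
  proof (intro conjI allI)
    show "\<R> \<subseteq> {A. infinite A}" using assms by (simp add: HL_family_def)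
    fix c :: "bool list \<Rightarrow> bool"
    obtain p A where "perfect_tree p" "A \<in> \<R>" "const_on c (p \<restriction>\<^sub>l A)"
      using assms unfolding HL_family_def by metis
    then show "\<exists>p. perfect_tree p \<and> (\<exists>A\<in>\<R>. \<forall>n\<in>A. const_on c (p \<restriction>\<^sub>l {n}))"
      using mono by (intro exI[of _ p] conjI bexI[of _ A] ballI)
  qed
qed

text \<open>The bound passes to \<open>min_size P\<close> because it is attained; the witness
  \<open>X\<close> guarantees this.\<close>

lemma min_size_mono:
  assumes "P X" and "\<And>Y. P Y \<Longrightarrow> min_size Q \<le>o |Y|"
  shows "min_size Q \<le>o min_size P"
  using min_size_witness[of P X] assms by metis

theorem theorem2p7:
  shows "hlt =o hlt' \<and> hlt' =o \<rr>"
proof -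
  note HL = HL_family_infinite_sets
  have "reaping_family {A. infinite A}"
    by (auto simp: reaping_family_def)
  then have 1: "hlt \<le>o \<rr>"
    unfolding hlt_def reaping_number_def
  proof (rule min_size_mono)
    fix \<R> assume "reaping_family \<R>"
    then consider "HL_family \<R>" | "|UNIV :: nat set set| \<le>o |\<R>|"
      using reaping_family_HL_or_continuum by blast
    then show "min_size HL_family \<le>o |\<R>|"
    proof cases
      \<comment> \<open>Here the family of all infinite sets, of size at most continuum, replaces
        \<R>.\<close>
      case 2
      have "min_size HL_family \<le>o |{A :: nat set. infinite A}|" using HL by (rule min_size_le)
      also have "|{A :: nat set. infinite A}| \<le>o |UNIV :: nat set set|" by (rule card_of_mono1) simp
      also note 2
      finally show ?thesis .
    qed (rule min_size_le)
  qed
  have 2: "hlt' \<le>o hlt"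
    unfolding hlt_def hlt'_def
    using HL by (rule min_size_mono) (intro min_size_le HL_family_imp_levels)
  have 3: "\<rr> \<le>o hlt'"
    using min_size_mono[of HL_family_levels, OF HL_family_imp_levels[OF HL], of reaping_family]
      HL_family_levels_ge_reaping_number
    unfolding hlt'_def reaping_number_def by blast
  show ?thesis
    using 1 2 3 by (meson ordIso_iff_ordLeq ordLeq_transitive)
qed

end
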